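(* Let $I\subset\mathbb R$ be an interval with nonempty interior, $u,v_1,v_2:I\to[0,\infty]$ measurable, $0<q<\infty$ and $1\le p_1,p_2\le\infty$. If $J\subset K\Subset I$ with $J,K$ nondegenerate compact intervals, then $$C_J\le C_K\le C_I.$$ Moreover, $$C_I=\sup_{J\Subset I}C_J.$$
   Context: For $a,b\in[0,\infty]$ put $a\odot b=0$ if $a=0$ or $b=0$, $a\odot b=ab$ if $0<a,b<\infty$, and $a\odot b=\infty$ otherwise. For measurable $E$, a measurable weight $w:E\to[0,\infty]$ and measurable $h\ge0$: $\|h\|_{L^s(w;E)}=\left(\int_Eh(t)^s\odot w(t)\,dt\right)^{1/s}$ for $0<s<\infty$ and $\|h\|_{L^\infty(w;E)}=\operatorname{ess\,sup}_{t\in E}(h(t)\odot w(t))$. All functions are nonnegative and measurable. $J\Subset I$ means $J=[c,d]$ is a nondegenerate compact interval contained in $I$. Let $H_Ih(x)=\int_{I\cap(-\infty,x]}h(t)\,dt$, $\mathcal B_I(f,g)=H_If\odot H_Ig$, and for $J=[c,d]\Subset I$ let $H_Jh(x)=\int_c^xh(t)\,dt$, $\mathcal B_J(f,g)=H_Jf\odot H_Jg$ on $J$. For $E=I$ or $E=J\Subset I$, $C_E$ is the infimum of all finite $C\ge0$ such that $\|\mathcal B_E(f,g)\|_{L^q(u;E)}\le C\|f\|_{L^{p_1}(v_1;E)}\|g\|_{L^{p_2}(v_2;E)}$ for all $f,g\ge0$ on $E$ with both input functionals finite; $\inf\varnothing=+\infty$. *)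

theory Defs
  imports "HOL-Probability.Essential_Supremum"
begin

text \<open>
  The product \<open>\<odot>\<close> on \<open>[0, \<infinity>]\<close> is the multiplication of \<^typ>\<open>ennreal\<close>:
\<close>

lemma ennreal_times_eq_odot:
  fixes a b :: ennreal
  shows "a * b = (if a = 0 \<or> b = 0 then 0
                  else if a < \<infinity> \<and> b < \<infinity> then ennreal (enn2real a * enn2real b)
                  else \<infinity>)"
  by (cases a; cases b)
     (auto simp: ennreal_mult ennreal_top_mult ennreal_mult_top infinity_ennreal_def)

text \<open>Powers with a real exponent \<open>s > 0\<close>, with \<open>0\<^sup>s = 0\<close> and \<open>\<infinity>\<^sup>s = \<infinity>\<close>.\<close>

definition epowr :: "ennreal \<Rightarrow> real \<Rightarrow> ennreal" where
  "epowr a s = (if a = \<infinity> then \<infinity> else ennreal (enn2real a powr s))"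

text \<open>
  The functional \<open>\<parallel>h\<parallel>\<close> on \<open>L\<^sup>s(w; E)\<close>, for an exponent \<open>0 < s \<le> \<infinity>\<close>. Functions on \<open>E\<close> are total
  functions of which only the restriction to \<open>E\<close> matters; measurable means Lebesgue measurable.
\<close>

definition wnorm ::
    "ennreal \<Rightarrow> (real \<Rightarrow> ennreal) \<Rightarrow> real set \<Rightarrow> (real \<Rightarrow> ennreal) \<Rightarrow> ennreal" where
  "wnorm s w E h =
     (if s = \<infinity> then esssup (lebesgue_on E) (\<lambda>t. h t * w t)
      else epowr (\<integral>\<^sup>+ t. epowr (h t) (enn2real s) * w t \<partial>lebesgue_on E) (1 / enn2real s))"

text \<open>For \<open>E = {c..d}\<close> and \<open>x \<in> E\<close>, the set \<open>E \<inter> {..x}\<close> is \<open>{c..x}\<close>.\<close>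

definition hardy :: "real set \<Rightarrow> (real \<Rightarrow> ennreal) \<Rightarrow> real \<Rightarrow> ennreal" where
  "hardy E h x = (\<integral>\<^sup>+ t. h t \<partial>lebesgue_on (E \<inter> {..x}))"

definition bilin_hardy ::
    "real set \<Rightarrow> (real \<Rightarrow> ennreal) \<Rightarrow> (real \<Rightarrow> ennreal) \<Rightarrow> real \<Rightarrow> ennreal" where
  "bilin_hardy E f g x = hardy E f x * hardy E g x"

text \<open>The best constant \<open>C\<^sub>E\<close>; the infimum of the empty set is \<open>\<infinity>\<close>.\<close>

definition best_const ::
    "ennreal \<Rightarrow> ennreal \<Rightarrow> ennreal \<Rightarrow> (real \<Rightarrow> ennreal) \<Rightarrow> (real \<Rightarrow> ennreal) \<Rightarrow> (real \<Rightarrow> ennreal)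
      \<Rightarrow> real set \<Rightarrow> ennreal" where
  "best_const q p1 p2 u v1 v2 E =
     Inf {C. C < \<infinity> \<and>
       (\<forall>f \<in> borel_measurable (lebesgue_on E). \<forall>g \<in> borel_measurable (lebesgue_on E).
          wnorm p1 v1 E f < \<infinity> \<longrightarrow> wnorm p2 v2 E g < \<infinity> \<longrightarrow>
          wnorm q u E (bilin_hardy E f g) \<le> C * wnorm p1 v1 E f * wnorm p2 v2 E g)}"

definition cpt_subinterval :: "real set \<Rightarrow> real set \<Rightarrow> bool" (infix "\<Subset>" 50) where
  "J \<Subset> I \<longleftrightarrow> (\<exists>c d. c < d \<and> J = {c..d} \<and> J \<subseteq> I)"

end

theory Submission
  imports Defs
begin

text \<open>
  Monotonicity: extending \<open>f\<close> and \<open>g\<close> by zero from \<open>A\<close> to a larger set \<open>B\<close> changes neither the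
  input functionals (\<open>wnorm_zero_extension\<close>) nor the Hardy integrals (\<open>hardy_zero_extension\<close>),
  while the output functional can only grow. So every constant admissible for \<open>B\<close> is admissible
  for \<open>A\<close>, which gives both inequalities and one half of the supremum formula.

  For the other half, exhaust \<open>I\<close> up to its endpoints by increasing compact intervals \<open>J n\<close>, and let
  \<open>C\<close> exceed the supremum of the \<open>C\<^sub>J\<close>. For \<open>f\<close>, \<open>g\<close> on \<open>I\<close>, the inequality with constant \<open>C\<close> holds on each
  \<open>J n\<close>, and its right-hand side is at most the corresponding expression on \<open>I\<close>. As \<open>n\<close> grows, the
  Hardy integrals over \<open>J n\<close> increase to those over \<open>I\<close>. Here the integration starts at the left
  endpoint of \<open>J n\<close>, so the integrand of the output functional varies with \<open>n\<close> along with the domain; both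
  effects are monotone, and monotone convergence (\<open>nn_integral_exhaustion\<close>) yields the
  inequality with constant \<open>C\<close> on \<open>I\<close>. Hence \<open>C\<^sub>I \<le> C\<close>. The assumption \<open>q < \<infinity>\<close> makes the output
  functional an integral to which monotone convergence applies.
\<close>

section \<open>Real powers on \<open>[0, \<infinity>]\<close>\<close>

text \<open>
  The map \<open>x \<mapsto> x\<^sup>s\<close> is an order isomorphism of \<open>[0, \<infinity>]\<close> with inverse \<open>y \<mapsto> y\<^bsup>1/s\<^esup>\<close>. In this form
  the fact gives monotonicity, measurability and preservation of suprema without any appeal to
  continuity.
\<close>

lemma epowr_le_iff:
  assumes "0 < s"
  shows "epowr x s \<le> y \<longleftrightarrow> x \<le> epowr y (1 / s)"
proof (cases x; cases y)
  fix a b assume ab: "0 \<le> a" "x = ennreal a" "0 \<le> b" "y = ennreal b"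
  have "a powr s \<le> b \<longleftrightarrow> a \<le> b powr (1 / s)"
  proof
    assume "a powr s \<le> b"
    then have "(a powr s) powr (1 / s) \<le> b powr (1 / s)"
      using assms by (intro powr_mono2) auto
    then show "a \<le> b powr (1 / s)"
      using assms ab by (simp add: powr_powr)
  next
    assume "a \<le> b powr (1 / s)"
    then have "a powr s \<le> (b powr (1 / s)) powr s"
      using assms ab by (intro powr_mono2) auto
    then show "a powr s \<le> b"
      using assms ab by (simp add: powr_powr)
  qed
  then show ?thesis
    using ab by (simp add: epowr_def)
qed (auto simp: epowr_def top_unique)

lemma epowr_mono: "0 < s \<Longrightarrow> x \<le> y \<Longrightarrow> epowr x s \<le> epowr y s"
  by (metis epowr_le_iff order_refl order_trans)

lemma epowr_0 [simp]: "epowr 0 s = 0"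
  by (simp add: epowr_def)

lemma epowr_SUP:
  assumes "0 < s"
  shows "epowr (SUP i\<in>A. a i) s = (SUP i\<in>A. epowr (a i) s)"
proof -
  have "epowr (SUP i\<in>A. a i) s \<le> y \<longleftrightarrow> (SUP i\<in>A. epowr (a i) s) \<le> y" for y
    by (simp add: epowr_le_iff[OF assms] SUP_le_iff)
  then show ?thesis
    by (meson order_antisym order_refl)
qed

lemma borel_measurable_epowr:
  assumes "0 < s" and h: "h \<in> borel_measurable M"
  shows "(\<lambda>x. epowr (h x) s) \<in> borel_measurable M"
proof (rule borel_measurableI_le)
  fix y
  show "{x \<in> space M. epowr (h x) s \<le> y} \<in> sets M"
    unfolding epowr_le_iff[OF \<open>0 < s\<close>] using h by measurable
qed

section \<open>Extension by zero\<close>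

lemma borel_measurable_zero_extension:
  fixes h :: "real \<Rightarrow> ennreal"
  assumes "A \<in> sets lebesgue" and "B \<in> sets lebesgue" and "A \<subseteq> B"
    and "h \<in> borel_measurable (lebesgue_on A)"
  shows "(\<lambda>x. h x * indicator A x) \<in> borel_measurable (lebesgue_on B)"
proof -
  have "(\<lambda>x. h x * indicator A x) \<in> borel_measurable lebesgue"
    using assms by (simp add: borel_measurable_restrict_space_iff_ennreal)
  then show ?thesis
    by (rule measurable_restrict_space1)
qed

lemma nn_integral_mono_set:
  fixes h :: "real \<Rightarrow> ennreal"
  assumes "A \<in> sets lebesgue" and "B \<in> sets lebesgue" and "A \<subseteq> B"
    and "\<And>x. x \<in> A \<Longrightarrow> h x \<le> k x"
  shows "(\<integral>\<^sup>+x. h x \<partial>lebesgue_on A) \<le> (\<integral>\<^sup>+x. k x \<partial>lebesgue_on B)"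
  using assms
  by (auto simp: nn_integral_restrict_space indicator_def intro!: nn_integral_mono)

lemma nn_integral_zero_extension:
  fixes h :: "real \<Rightarrow> ennreal"
  assumes "A \<in> sets lebesgue" and "B \<in> sets lebesgue" and "A \<subseteq> B"
    and "\<And>x. x \<in> A \<Longrightarrow> k x = h x" and "\<And>x. x \<in> B - A \<Longrightarrow> k x = 0"
  shows "(\<integral>\<^sup>+x. k x \<partial>lebesgue_on B) = (\<integral>\<^sup>+x. h x \<partial>lebesgue_on A)"
  using assms
  by (auto simp: nn_integral_restrict_space indicator_def intro!: nn_integral_cong)

lemma esssup_zero_extension:
  fixes h w :: "real \<Rightarrow> ennreal"
  assumes A: "A \<in> sets lebesgue" and B: "B \<in> sets lebesgue" and "A \<subseteq> B"
    and h: "h \<in> borel_measurable (lebesgue_on A)" and w: "w \<in> borel_measurable (lebesgue_on B)"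
  shows "esssup (lebesgue_on B) (\<lambda>t. h t * indicator A t * w t)
    = esssup (lebesgue_on A) (\<lambda>t. h t * w t)"
proof -
  have "w \<in> borel_measurable (lebesgue_on A)"
    using w \<open>A \<subseteq> B\<close> by (rule measurable_restrict_mono)
  then have 1: "(\<lambda>t. h t * w t) \<in> borel_measurable (lebesgue_on A)"
    using h by (rule borel_measurable_times_ennreal[rotated])
  have 2: "(\<lambda>t. h t * indicator A t * w t) \<in> borel_measurable (lebesgue_on B)"
    using borel_measurable_zero_extension[OF A B \<open>A \<subseteq> B\<close> h] w
    by (rule borel_measurable_times_ennreal)
  (* The essential supremum is at least 0 for the values in question, so the zeros that the
     extension adds do not raise it. *)
  have "(AE t in lebesgue_on B. h t * indicator A t * w t \<le> z)
      \<longleftrightarrow> (AE t in lebesgue_on A. h t * w t \<le> z)" for z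
    using A B \<open>A \<subseteq> B\<close>
    by (auto simp: AE_restrict_space_iff indicator_def intro!: AE_cong)
  then show ?thesis
    by (simp add: esssup_eq_AE[OF 1] esssup_eq_AE[OF 2])
qed

lemma wnorm_zero_extension:
  assumes "A \<in> sets lebesgue" and "B \<in> sets lebesgue" and "A \<subseteq> B"
    and "h \<in> borel_measurable (lebesgue_on A)" and "w \<in> borel_measurable (lebesgue_on B)"
  shows "wnorm s w B (\<lambda>t. h t * indicator A t) = wnorm s w A h"
proof -
  have "(\<integral>\<^sup>+ t. epowr (h t * indicator A t) r * w t \<partial>lebesgue_on B)
      = (\<integral>\<^sup>+ t. epowr (h t) r * w t \<partial>lebesgue_on A)" for r
    using assms(1-3) by (rule nn_integral_zero_extension) auto
  then show ?thesis
    using esssup_zero_extension[OF assms] by (simp add: wnorm_def)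
qed

lemma hardy_zero_extension:
  assumes "A \<in> sets lebesgue" and "B \<in> sets lebesgue" and "A \<subseteq> B"
  shows "hardy B (\<lambda>t. h t * indicator A t) = hardy A h"
proof
  fix x
  have "A \<inter> {..x} \<in> sets lebesgue" "B \<inter> {..x} \<in> sets lebesgue"
    using assms by auto
  then show "hardy B (\<lambda>t. h t * indicator A t) x = hardy A h x"
    unfolding hardy_def
    by (rule nn_integral_zero_extension) (use \<open>A \<subseteq> B\<close> in \<open>auto simp: indicator_def\<close>)
qed

section \<open>Monotonicity in the domain\<close>

text \<open>
  For arbitrary \<open>h\<close> and \<open>w\<close> and \<open>s = \<infinity>\<close> this rests on a convention: the essential supremum of a
  nonmeasurable function is \<open>\<infinity>\<close>, and a function that is not measurable on \<open>A\<close> is not measurable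
  on \<open>B\<close>.
\<close>

lemma wnorm_mono_set:
  assumes A: "A \<in> sets lebesgue" and B: "B \<in> sets lebesgue" and "A \<subseteq> B" and "0 < s"
  shows "wnorm s w A h \<le> wnorm s w B h"
proof (cases "s = \<infinity>")
  case True
  let ?k = "\<lambda>t. h t * w t"
  have "esssup (lebesgue_on A) ?k \<le> esssup (lebesgue_on B) ?k"
  proof (cases "?k \<in> borel_measurable (lebesgue_on B)")
    case True
    then have "?k \<in> borel_measurable (lebesgue_on A)"
      using \<open>A \<subseteq> B\<close> by (rule measurable_restrict_mono)
    moreover have "AE t in lebesgue_on A. ?k t \<le> esssup (lebesgue_on B) ?k"
      using esssup_AE[of ?k "lebesgue_on B"] A B \<open>A \<subseteq> B\<close>
      by (auto simp: AE_restrict_space_iff elim!: eventually_mono)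
    ultimately show ?thesis
      by (rule esssup_I)
  qed (simp add: esssup_non_measurable)
  then show ?thesis
    using True by (simp add: wnorm_def)
next
  case False
  then have "0 < 1 / enn2real s"
    using \<open>0 < s\<close> by (simp add: enn2real_positive_iff less_top)
  moreover have "(\<integral>\<^sup>+ t. epowr (h t) (enn2real s) * w t \<partial>lebesgue_on A)
      \<le> (\<integral>\<^sup>+ t. epowr (h t) (enn2real s) * w t \<partial>lebesgue_on B)"
    using A B \<open>A \<subseteq> B\<close> by (rule nn_integral_mono_set) auto
  ultimately show ?thesis
    using False by (auto simp: wnorm_def intro: epowr_mono)
qed

text \<open>
  The value \<open>C = \<infinity>\<close> is included, so that the admissible constants form an upward closed set.
\<close>

definition admissible ::
    "ennreal \<Rightarrow> ennreal \<Rightarrow> ennreal \<Rightarrow> (real \<Rightarrow> ennreal) \<Rightarrow> (real \<Rightarrow> ennreal) \<Rightarrow> (real \<Rightarrow> ennreal)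
      \<Rightarrow> real set \<Rightarrow> ennreal \<Rightarrow> bool" where
  "admissible q p1 p2 u v1 v2 E C \<longleftrightarrow>
     (\<forall>f \<in> borel_measurable (lebesgue_on E). \<forall>g \<in> borel_measurable (lebesgue_on E).
        wnorm p1 v1 E f < \<infinity> \<longrightarrow> wnorm p2 v2 E g < \<infinity> \<longrightarrow>
        wnorm q u E (bilin_hardy E f g) \<le> C * wnorm p1 v1 E f * wnorm p2 v2 E g)"

lemma best_const_eq: "best_const q p1 p2 u v1 v2 E = Inf {C. C < \<infinity> \<and> admissible q p1 p2 u v1 v2 E C}"
  by (simp add: best_const_def admissible_def)

lemma admissible_mono:
  assumes C: "admissible q p1 p2 u v1 v2 E C" and "C \<le> D"
  shows "admissible q p1 p2 u v1 v2 E D"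
  unfolding admissible_def
proof (intro ballI impI)
  fix f g
  assume "f \<in> borel_measurable (lebesgue_on E)" "g \<in> borel_measurable (lebesgue_on E)"
    "wnorm p1 v1 E f < \<infinity>" "wnorm p2 v2 E g < \<infinity>"
  then have "wnorm q u E (bilin_hardy E f g) \<le> C * wnorm p1 v1 E f * wnorm p2 v2 E g"
    using C by (simp add: admissible_def)
  also have "\<dots> \<le> D * wnorm p1 v1 E f * wnorm p2 v2 E g"
    using \<open>C \<le> D\<close> by (intro mult_right_mono) auto
  finally show "wnorm q u E (bilin_hardy E f g) \<le> D * wnorm p1 v1 E f * wnorm p2 v2 E g" .
qed

lemma admissible_if_best_const_less:
  assumes "best_const q p1 p2 u v1 v2 E < C"
  shows "admissible q p1 p2 u v1 v2 E C"
  using assms unfolding best_const_eq Inf_less_iff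
  by (auto intro: admissible_mono less_imp_le)

lemma admissible_subset:
  assumes A: "A \<in> sets lebesgue" and B: "B \<in> sets lebesgue" and "A \<subseteq> B"
    and "0 < q"
    and v1: "v1 \<in> borel_measurable (lebesgue_on B)" and v2: "v2 \<in> borel_measurable (lebesgue_on B)"
    and C: "admissible q p1 p2 u v1 v2 B C"
  shows "admissible q p1 p2 u v1 v2 A C"
  unfolding admissible_def
proof (intro ballI impI)
  fix f g
  assume f: "f \<in> borel_measurable (lebesgue_on A)" and g: "g \<in> borel_measurable (lebesgue_on A)"
    and fin: "wnorm p1 v1 A f < \<infinity>" "wnorm p2 v2 A g < \<infinity>"
  let ?f = "\<lambda>t. f t * indicator A t" and ?g = "\<lambda>t. g t * indicator A t"
  note ext = A B \<open>A \<subseteq> B\<close>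
  have norms: "wnorm p1 v1 B ?f = wnorm p1 v1 A f" "wnorm p2 v2 B ?g = wnorm p2 v2 A g"
    using wnorm_zero_extension[OF ext f v1] wnorm_zero_extension[OF ext g v2] by auto
  have "bilin_hardy A f g = bilin_hardy B ?f ?g"
    by (simp add: bilin_hardy_def hardy_zero_extension[OF ext] fun_eq_iff)
  then have "wnorm q u A (bilin_hardy A f g) \<le> wnorm q u B (bilin_hardy B ?f ?g)"
    using wnorm_mono_set[OF ext \<open>0 < q\<close>] by simp
  also have "\<dots> \<le> C * wnorm p1 v1 B ?f * wnorm p2 v2 B ?g"
    using C borel_measurable_zero_extension[OF ext f] borel_measurable_zero_extension[OF ext g]
      fin[folded norms]
    unfolding admissible_def by blast
  finally show "wnorm q u A (bilin_hardy A f g) \<le> C * wnorm p1 v1 A f * wnorm p2 v2 A g"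
    by (simp add: norms)
qed

lemma best_const_mono_set:
  assumes "A \<in> sets lebesgue" and "B \<in> sets lebesgue" and "A \<subseteq> B" and "0 < q"
    and "v1 \<in> borel_measurable (lebesgue_on B)" and "v2 \<in> borel_measurable (lebesgue_on B)"
  shows "best_const q p1 p2 u v1 v2 A \<le> best_const q p1 p2 u v1 v2 B"
  unfolding best_const_eq
  by (rule Inf_superset_mono) (auto intro: admissible_subset[OF assms])

section \<open>Passage to the limit along an exhaustion\<close>

text \<open>
  Monotone convergence with integrand and domain increasing together. An exhaustion of \<open>E\<close> may miss
  a null set, so that an interval can be exhausted from its interior, whether or not it contains
  its endpoints.
\<close>

lemma nn_integral_exhaustion:
  fixes F :: "nat \<Rightarrow> real \<Rightarrow> ennreal"
  assumes E: "E \<in> sets lebesgue" and J: "\<And>n. J n \<in> sets lebesgue" and sub: "\<And>n. J n \<subseteq> E"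
    and "incseq J" and null: "E - (\<Union>n. J n) \<in> null_sets lebesgue"
    and F: "\<And>n. F n \<in> borel_measurable (lebesgue_on E)" and incF: "\<And>x. incseq (\<lambda>n. F n x)"
  shows "(\<integral>\<^sup>+x. (SUP n. F n x) \<partial>lebesgue_on E) = (SUP n. \<integral>\<^sup>+x. F n x \<partial>lebesgue_on (J n))"
proof -
  have incJ: "x \<in> J m \<Longrightarrow> m \<le> n \<Longrightarrow> x \<in> J n" for x m n
    using \<open>incseq J\<close> by (auto simp: incseq_def)
  have pointwise: "(SUP n. F n x) * indicator E x = (SUP n. F n x * indicator (J n) x)"
    if x: "x \<notin> E - (\<Union>n. J n)" for x
  proof (cases "x \<in> E")
    case True
    then obtain m where m: "x \<in> J m"
      using x by auto
    have "(SUP n. F n x) \<le> (SUP n. F n x * indicator (J n) x)"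
    proof (rule SUP_least)
      fix n
      have "F n x \<le> F (max n m) x * indicator (J (max n m)) x"
        using incseqD[OF incF, of n "max n m"] incJ[OF m] by simp
      then show "F n x \<le> (SUP n. F n x * indicator (J n) x)"
        by (rule SUP_upper2[OF UNIV_I])
    qed
    moreover have "(SUP n. F n x * indicator (J n) x) \<le> (SUP n. F n x)"
      by (rule SUP_mono) (auto simp: indicator_def)
    ultimately show ?thesis
      using True by simp
  next
    case False
    then have "x \<notin> J n" for n
      using sub by auto
    with False show ?thesis
      by simp
  qed
  have "(\<integral>\<^sup>+x. (SUP n. F n x) \<partial>lebesgue_on E)
      = (\<integral>\<^sup>+x. (SUP n. F n x) * indicator E x \<partial>lebesgue)"
    using E by (simp add: nn_integral_restrict_space)
  also have "\<dots> = (\<integral>\<^sup>+x. (SUP n. F n x * indicator (J n) x) \<partial>lebesgue)"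
    by (rule nn_integral_cong_AE, rule AE_I'[OF null]) (use pointwise in blast)
  also have "\<dots> = (SUP n. \<integral>\<^sup>+x. F n x * indicator (J n) x \<partial>lebesgue)"
  proof (rule nn_integral_monotone_convergence_SUP)
    show "incseq (\<lambda>n x. F n x * indicator (J n) x)"
      using incJ incF by (auto simp: incseq_def le_fun_def indicator_def)
    show "(\<lambda>x. F n x * indicator (J n) x) \<in> borel_measurable lebesgue" for n
      using measurable_restrict_mono[OF F sub] J
      by (simp add: borel_measurable_restrict_space_iff_ennreal)
  qed
  also have "\<dots> = (SUP n. \<integral>\<^sup>+x. F n x \<partial>lebesgue_on (J n))"
    using J by (simp add: nn_integral_restrict_space)
  finally show ?thesis .
qed

lemma hardy_mono_set:
  assumes "A \<in> sets lebesgue" and "B \<in> sets lebesgue" and "A \<subseteq> B"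
  shows "hardy A h x \<le> hardy B h x"
  unfolding hardy_def by (rule nn_integral_mono_set) (use assms in auto)

lemma hardy_exhaustion:
  assumes E: "E \<in> sets lebesgue" and J: "\<And>n. J n \<in> sets lebesgue" and sub: "\<And>n. J n \<subseteq> E"
    and "incseq J" and null: "E - (\<Union>n. J n) \<in> null_sets lebesgue"
    and h: "h \<in> borel_measurable (lebesgue_on E)"
  shows "hardy E h x = (SUP n. hardy (J n) h x)"
proof -
  have "E \<inter> {..x} - (\<Union>n. J n \<inter> {..x}) \<in> null_sets lebesgue"
    using null
  proof (rule null_sets_subset)
    show "E \<inter> {..x} - (\<Union>n. J n \<inter> {..x}) \<in> sets lebesgue"
      using E J by (intro sets.Diff sets.countable_UN sets.Int) auto
  qed auto
  moreover have "incseq (\<lambda>n. J n \<inter> {..x})"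
    using \<open>incseq J\<close> by (auto simp: incseq_def)
  moreover have "h \<in> borel_measurable (lebesgue_on (E \<inter> {..x}))"
    using h by (rule measurable_restrict_mono) auto
  moreover have "E \<inter> {..x} \<in> sets lebesgue" "J n \<inter> {..x} \<in> sets lebesgue" for n
    using E J by (auto intro!: sets.Int)
  moreover have "J n \<inter> {..x} \<subseteq> E \<inter> {..x}" for n
    using sub by auto
  ultimately show ?thesis
    unfolding hardy_def
    using nn_integral_exhaustion[of "E \<inter> {..x}" "\<lambda>n. J n \<inter> {..x}" "\<lambda>n. h"] by simp
qed

text \<open>
  A Hardy integral is an increasing function of its upper limit, so its sublevel sets are intervals.
\<close>

lemma borel_measurable_hardy:
  assumes E: "E \<in> sets lebesgue"
  shows "hardy E h \<in> borel_measurable (lebesgue_on A)"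
proof -
  have mono: "hardy E h x \<le> hardy E h y" if "x \<le> y" for x y
    unfolding hardy_def by (rule nn_integral_mono_set) (use E that in auto)
  have "hardy E h \<in> borel_measurable borel"
  proof (rule borel_measurableI_le)
    fix z
    have "is_interval {x. hardy E h x \<le> z}"
      unfolding is_interval_1 using mono order_trans by blast
    then show "{x \<in> space borel. hardy E h x \<le> z} \<in> sets borel"
      by (simp add: real_interval_borel_measurable)
  qed
  then show ?thesis
    by (intro measurable_restrict_space1 measurable_completion) simp
qed

lemma SUP_mult_incseq_ennreal:
  fixes a b :: "nat \<Rightarrow> ennreal"
  assumes "incseq a" and "incseq b"
  shows "(SUP n. a n) * (SUP n. b n) = (SUP n. a n * b n)"
proof (rule antisym)
  have "a m * b n \<le> (SUP n. a n * b n)" for m n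
    by (rule SUP_upper2[of "max m n"])
      (auto intro!: mult_mono incseqD[OF assms(1)] incseqD[OF assms(2)])
  then show "(SUP n. a n) * (SUP n. b n) \<le> (SUP n. a n * b n)"
    by (auto simp: SUP_mult_left_ennreal SUP_mult_right_ennreal intro!: SUP_least)
  show "(SUP n. a n * b n) \<le> (SUP n. a n) * (SUP n. b n)"
    by (intro SUP_least mult_mono SUP_upper) auto
qed

text \<open>
  The Fatou property of the bilinear operator: the bound is required only for the operators
  \<open>bilin_hardy (J n)\<close>, each of which ignores the mass of \<open>f\<close> and \<open>g\<close> outside \<open>J n\<close>.
\<close>

lemma wnorm_bilin_hardy_exhaustion_le:
  assumes E: "E \<in> sets lebesgue" and J: "\<And>n. J n \<in> sets lebesgue" and sub: "\<And>n. J n \<subseteq> E"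
    and "incseq J" and null: "E - (\<Union>n. J n) \<in> null_sets lebesgue"
    and "0 < q" and "q < \<infinity>" and u: "u \<in> borel_measurable (lebesgue_on E)"
    and f: "f \<in> borel_measurable (lebesgue_on E)" and g: "g \<in> borel_measurable (lebesgue_on E)"
    and bound: "\<And>n. wnorm q u (J n) (bilin_hardy (J n) f g) \<le> R"
  shows "wnorm q u E (bilin_hardy E f g) \<le> R"
proof -
  let ?s = "enn2real q"
  have s: "0 < ?s"
    using \<open>0 < q\<close> \<open>q < \<infinity>\<close> by (simp add: enn2real_positive_iff)
  have wnorm_le: "wnorm q u A h \<le> R
      \<longleftrightarrow> (\<integral>\<^sup>+t. epowr (h t) ?s * u t \<partial>lebesgue_on A) \<le> epowr R ?s" for A h
    using \<open>q < \<infinity>\<close> s by (auto simp: wnorm_def epowr_le_iff)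
  have incJ: "m \<le> n \<Longrightarrow> J m \<subseteq> J n" for m n
    using \<open>incseq J\<close> by (rule incseqD)
  have inc: "incseq (\<lambda>n. hardy (J n) h x)" for h x
    by (auto simp: incseq_def intro!: hardy_mono_set J incJ)
  let ?F = "\<lambda>n t. epowr (bilin_hardy (J n) f g t) ?s * u t"
  have "bilin_hardy E f g x = (SUP n. bilin_hardy (J n) f g x)" for x
    unfolding bilin_hardy_def hardy_exhaustion[OF E J sub \<open>incseq J\<close> null f]
      hardy_exhaustion[OF E J sub \<open>incseq J\<close> null g]
    by (rule SUP_mult_incseq_ennreal[OF inc inc])
  then have "epowr (bilin_hardy E f g t) ?s * u t = (SUP n. ?F n t)" for t
    by (simp add: epowr_SUP[OF s] SUP_mult_right_ennreal)
  then have "(\<integral>\<^sup>+t. epowr (bilin_hardy E f g t) ?s * u t \<partial>lebesgue_on E)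
      = (\<integral>\<^sup>+t. (SUP n. ?F n t) \<partial>lebesgue_on E)"
    by simp
  also have "\<dots> = (SUP n. \<integral>\<^sup>+t. ?F n t \<partial>lebesgue_on (J n))"
  proof (rule nn_integral_exhaustion[OF E J sub \<open>incseq J\<close> null])
    show "?F n \<in> borel_measurable (lebesgue_on E)" for n
      unfolding bilin_hardy_def
      by (intro borel_measurable_times_ennreal borel_measurable_epowr s u
          borel_measurable_hardy J)
    show "incseq (\<lambda>n. ?F n x)" for x
      unfolding incseq_def bilin_hardy_def
      by (auto intro!: mult_mono epowr_mono s incseqD[OF inc])
  qed
  also have "\<dots> \<le> epowr R ?s"
    using bound by (auto simp: wnorm_le intro: SUP_least)
  finally show ?thesis
    by (simp add: wnorm_le)
qed

lemma best_const_le_exhaustion: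
  assumes E: "E \<in> sets lebesgue" and J: "\<And>n. J n \<in> sets lebesgue" and sub: "\<And>n. J n \<subseteq> E"
    and "incseq J" and null: "E - (\<Union>n. J n) \<in> null_sets lebesgue"
    and "0 < q" and "q < \<infinity>" and "0 < p1" and "0 < p2"
    and u: "u \<in> borel_measurable (lebesgue_on E)"
  shows "best_const q p1 p2 u v1 v2 E \<le> (SUP n. best_const q p1 p2 u v1 v2 (J n))"
proof (rule dense_ge)
  (* A constant strictly above every best constant is admissible on every J n: the
     infimum that defines the best constant on J n has admissible constants below C. *)
  fix C
  assume C: "(SUP n. best_const q p1 p2 u v1 v2 (J n)) < C"
  have "best_const q p1 p2 u v1 v2 (J n) < C" for n
    using C by (rule le_less_trans[OF SUP_upper[OF UNIV_I]])
  then have adm: "admissible q p1 p2 u v1 v2 (J n) C" for n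
    by (rule admissible_if_best_const_less)
  have "admissible q p1 p2 u v1 v2 E C"
    unfolding admissible_def
  proof (intro ballI impI)
    fix f g
    assume f: "f \<in> borel_measurable (lebesgue_on E)" and g: "g \<in> borel_measurable (lebesgue_on E)"
      and fin: "wnorm p1 v1 E f < \<infinity>" "wnorm p2 v2 E g < \<infinity>"
    show "wnorm q u E (bilin_hardy E f g) \<le> C * wnorm p1 v1 E f * wnorm p2 v2 E g"
    proof (rule wnorm_bilin_hardy_exhaustion_le
        [OF E J sub \<open>incseq J\<close> null \<open>0 < q\<close> \<open>q < \<infinity>\<close> u f g])
      fix n
      have le: "wnorm p1 v1 (J n) f \<le> wnorm p1 v1 E f" "wnorm p2 v2 (J n) g \<le> wnorm p2 v2 E g"
        using wnorm_mono_set[OF J E sub] \<open>0 < p1\<close> \<open>0 < p2\<close> by auto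
      have "wnorm q u (J n) (bilin_hardy (J n) f g)
          \<le> C * wnorm p1 v1 (J n) f * wnorm p2 v2 (J n) g"
        using adm[of n] le fin measurable_restrict_mono[OF f sub[of n]]
          measurable_restrict_mono[OF g sub[of n]]
        by (simp add: admissible_def le_less_trans)
      also have "\<dots> \<le> C * wnorm p1 v1 E f * wnorm p2 v2 E g"
        using le by (intro mult_mono) auto
      finally show "wnorm q u (J n) (bilin_hardy (J n) f g)
          \<le> C * wnorm p1 v1 E f * wnorm p2 v2 E g" .
    qed
  qed
  then show "best_const q p1 p2 u v1 v2 E \<le> C"
    by (cases "C < \<infinity>") (auto simp: best_const_eq not_less top_unique intro: Inf_lower)
qed

section \<open>Compact subintervals\<close>

text \<open>
  The exhaustion lies between the infimum and the supremum of \<open>I\<close> in the extended reals. At most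
  these two points of \<open>I\<close> are missed.
\<close>

lemma interval_compact_exhaustion:
  fixes I :: "real set"
  assumes I: "is_interval I" and int: "interior I \<noteq> {}"
  obtains J :: "nat \<Rightarrow> real set"
  where "\<And>n. J n \<Subset> I" and "incseq J" and "I - (\<Union>n. J n) \<in> null_sets lebesgue"
proof -
  define a b where "a = (INF x\<in>I. ereal x)" and "b = (SUP x\<in>I. ereal x)"
  have ab: "a \<le> ereal x" "ereal x \<le> b" if "x \<in> I" for x
    using that by (auto simp: a_def b_def intro: INF_lower SUP_upper)
  obtain x y where xy: "x \<in> I" "y \<in> I" "x < y"
  proof -
    obtain x where x: "x \<in> interior I"
      using int by auto
    then obtain e where "0 < e" "cball x e \<subseteq> I"
      by (auto simp: mem_interior_cball)
    then show thesis
      by (intro that[of x "x + e"]) (auto simp: subset_eq dist_real_def)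
  qed
  then have "ereal x < ereal y"
    by simp
  then have "a < b"
    using ab(1)[OF xy(1)] ab(2)[OF xy(2)] by (meson le_less_trans less_le_trans)
  obtain r l :: "nat \<Rightarrow> real" where lr: "einterval a b = (\<Union>i. {l i .. r i})"
    "incseq r" "decseq l" "\<And>i. l i < r i" "\<And>i. a < l i" "\<And>i. r i < b"
    "l \<longlonglongrightarrow> a" "r \<longlonglongrightarrow> b"
    by (blast intro: einterval_Icc_approximation[OF \<open>a < b\<close>])
  show thesis
  proof
    fix n
    obtain x where x: "x \<in> I" "x < l n"
      using lr(5)[of n] by (auto simp: a_def INF_less_iff)
    obtain y where y: "y \<in> I" "r n < y"
      using lr(6)[of n] by (auto simp: b_def less_SUP_iff)
    have "{l n..r n} \<subseteq> I"
    proof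
      fix z assume "z \<in> {l n..r n}"
      then have "x \<le> z" "z \<le> y"
        using x y by auto
      with x y I show "z \<in> I"
        unfolding is_interval_1 by blast
    qed
    then show "{l n..r n} \<Subset> I"
      using lr(4) unfolding cpt_subinterval_def by blast
  next
    show "incseq (\<lambda>n. {l n..r n})"
      unfolding incseq_def
    proof (intro allI impI)
      fix m n :: nat assume "m \<le> n"
      then show "{l m..r m} \<subseteq> {l n..r n}"
        using incseqD[OF lr(2)] decseqD[OF lr(3)] by (simp add: atLeastatMost_subset_iff)
    qed
  next
    have "I - (\<Union>n. {l n..r n}) \<subseteq> {real_of_ereal a, real_of_ereal b}"
    proof
      fix x assume "x \<in> I - (\<Union>n. {l n..r n})"
      then have "x \<in> I" "\<not> (a < ereal x \<and> ereal x < b)"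
        unfolding lr(1)[symmetric] by (auto simp: einterval_def)
      then have "ereal x = a \<or> ereal x = b"
        using ab[of x] by auto
      then show "x \<in> {real_of_ereal a, real_of_ereal b}"
        by (metis insertCI real_of_ereal.simps(1))
    qed
    then have "negligible (I - (\<Union>n. {l n..r n}))"
      by (rule negligible_subset[rotated]) auto
    then show "I - (\<Union>n. {l n..r n}) \<in> null_sets lebesgue"
      by (simp add: negligible_iff_null_sets)
  qed
qed

lemma cpt_subinterval_sets: "J \<Subset> I \<Longrightarrow> J \<in> sets lebesgue"
  by (auto simp: cpt_subinterval_def)

lemma cpt_subinterval_subset: "J \<Subset> I \<Longrightarrow> J \<subseteq> I"
  by (auto simp: cpt_subinterval_def)

theorem proposition2p2:
  fixes I :: "real set" and u v1 v2 :: "real \<Rightarrow> ennreal" and q p1 p2 :: ennreal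
  assumes "is_interval I" and "interior I \<noteq> {}"
    and "u \<in> borel_measurable (lebesgue_on I)"
    and "v1 \<in> borel_measurable (lebesgue_on I)"
    and "v2 \<in> borel_measurable (lebesgue_on I)"
    and "0 < q" and "q < \<infinity>"
    and "1 \<le> p1" and "1 \<le> p2"
  shows "(\<forall>J K. J \<Subset> K \<and> K \<Subset> I \<longrightarrow>
            best_const q p1 p2 u v1 v2 J \<le> best_const q p1 p2 u v1 v2 K \<and>
            best_const q p1 p2 u v1 v2 K \<le> best_const q p1 p2 u v1 v2 I) \<and>
         best_const q p1 p2 u v1 v2 I = (SUP J\<in>{J. J \<Subset> I}. best_const q p1 p2 u v1 v2 J)"
proof -
  have I: "I \<in> sets lebesgue"
    using \<open>is_interval I\<close> by (simp add: real_interval_borel_measurable)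
  have mono: "best_const q p1 p2 u v1 v2 A \<le> best_const q p1 p2 u v1 v2 B"
    if "A \<Subset> B" "B \<in> sets lebesgue" "B \<subseteq> I" for A B
    using that assms
    by (intro best_const_mono_set cpt_subinterval_sets[of A B] cpt_subinterval_subset)
      (auto intro: measurable_restrict_mono)
  obtain J where J: "\<And>n. J n \<Subset> I" and "incseq J"
    and null: "I - (\<Union>n. J n) \<in> null_sets lebesgue"
    using interval_compact_exhaustion assms(1,2) by metis
  have "0 < p1" "0 < p2"
    using \<open>1 \<le> p1\<close> \<open>1 \<le> p2\<close> zero_less_one less_le_trans by blast+
  then have "best_const q p1 p2 u v1 v2 I \<le> (SUP n. best_const q p1 p2 u v1 v2 (J n))"
    using I J assms
    by (intro best_const_le_exhaustion \<open>incseq J\<close> null)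
      (auto intro: cpt_subinterval_sets dest: cpt_subinterval_subset)
  also have "\<dots> \<le> (SUP J\<in>{J. J \<Subset> I}. best_const q p1 p2 u v1 v2 J)"
    using J by (intro SUP_mono) auto
  finally have "best_const q p1 p2 u v1 v2 I = (SUP J\<in>{J. J \<Subset> I}. best_const q p1 p2 u v1 v2 J)"
    using mono[of _ I] I by (intro antisym SUP_least) auto
  moreover have "best_const q p1 p2 u v1 v2 J \<le> best_const q p1 p2 u v1 v2 K \<and>
      best_const q p1 p2 u v1 v2 K \<le> best_const q p1 p2 u v1 v2 I"
    if "J \<Subset> K" "K \<Subset> I" for J K
    using that mono I cpt_subinterval_sets[of K I] cpt_subinterval_subset[of K I] by simp
  ultimately show ?thesis
    by blast
qed

end
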